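(* The virtual singular twin monoid $VSTM_n$ has the following reduced monoid presentation. Generators: $s_1,\tau_1,\nu_1,\dots,\nu_{n-1}$. Relations: 1. $\nu_i\nu_j\nu_i=\nu_j\nu_i\nu_j$ for $|i-j|=1$; 2. $\nu_i\nu_j=\nu_j\nu_i$ for $|i-j|\ge2$; 3. $\nu_i^2=1$ for $1\le i\le n-1$, and $s_1^2=1$; 4. $s_1\tau_1=\tau_1s_1$; 5. $\tau_1\nu_i=\nu_i\tau_1$ and $s_1\nu_i=\nu_is_1$ for $i\ge3$; 6. $\tau_1(\nu_1\nu_2s_1\nu_2\nu_1)s_1=(\nu_1\nu_2s_1\nu_2\nu_1)s_1(\nu_1\nu_2\tau_1\nu_2\nu_1)$; 7. $s_1(\nu_2\nu_3\nu_1\nu_2s_1\nu_2\nu_1\nu_3\nu_2)=(\nu_2\nu_3\nu_1\nu_2s_1\nu_2\nu_1\nu_3\nu_2)s_1$; 8. $\tau_1(\nu_2\nu_3\nu_1\nu_2s_1\nu_2\nu_1\nu_3\nu_2)=(\nu_2\nu_3\nu_1\nu_2s_1\nu_2\nu_1\nu_3\nu_2)\tau_1$; 9. $\tau_1(\nu_2\nu_3\nu_1\nu_2\tau_1\nu_2\nu_1\nu_3\nu_2)=(\nu_2\nu_3\nu_1\nu_2\tau_1\nu_2\nu_1\nu_3\nu_2)\tau_1$. Here the remaining generators of $VSTM_n$ are expressed, for $1\le i\le n-2$, as $$s_{i+1}=(\nu_i\cdots\nu_2\nu_1)(\nu_{i+1}\cdots\nu_3\nu_2)\,s_1\,(\nu_2\nu_3\cdots\nu_{i+1})(\nu_1\nu_2\cdots\nu_i),$$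 $$\tau_{i+1}=(\nu_i\cdots\nu_2\nu_1)(\nu_{i+1}\cdots\nu_3\nu_2)\,\tau_1\,(\nu_2\nu_3\cdots\nu_{i+1})(\nu_1\nu_2\cdots\nu_i).$$
   Context: The virtual singular twin monoid $VSTM_n$ is the monoid generated by $s_i,\tau_i,\nu_i$ ($1\le i\le n-1$) subject to: $s_i^2=1$, $\nu_i^2=1$ and $\tau_is_i=s_i\tau_i$ for all $i$; $s_is_j\tau_i=\tau_js_is_j$, $\nu_i\nu_j\nu_i=\nu_j\nu_i\nu_j$, $\nu_is_j\nu_i=\nu_js_i\nu_j$, $\nu_i\tau_j\nu_i=\nu_j\tau_i\nu_j$ for $|i-j|=1$; and $g_ih_j=h_jg_i$ for $|i-j|\ge 2$, where $g_i,h_i\in\{s_i,\tau_i,\nu_i\}$. All generator indices range over $1,\dots,n-1$; a relation is imposed only when all the generators occurring in it exist for the given $n$. *)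

theory Defs
  imports "HOL-Algebra.Group"
begin

section \<open>Monoid presentations\<close>

inductive_set word_cong :: "'a set \<Rightarrow> ('a list \<times> 'a list) set \<Rightarrow> ('a list \<times> 'a list) set"
  for X :: "'a set" and R :: "('a list \<times> 'a list) set" where
  base: "r \<in> R \<Longrightarrow> r \<in> word_cong X R"
| refl: "w \<in> lists X \<Longrightarrow> (w, w) \<in> word_cong X R"
| sym: "(u, v) \<in> word_cong X R \<Longrightarrow> (v, u) \<in> word_cong X R"
| trans: "(u, v) \<in> word_cong X R \<Longrightarrow> (v, w) \<in> word_cong X R \<Longrightarrow> (u, w) \<in> word_cong X R"
| append: "(u, u') \<in> word_cong X R \<Longrightarrow> (v, v') \<in> word_cong X R \<Longrightarrow> (u @ v, u' @ v') \<in> word_cong X R"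

definition word_class :: "'a set \<Rightarrow> ('a list \<times> 'a list) set \<Rightarrow> 'a list \<Rightarrow> 'a list set" where
  "word_class X R w = word_cong X R `` {w}"

text \<open>The monoid presented by generators \<open>X\<close> and relations \<open>R \<subseteq> lists X \<times> lists X\<close>:
  the quotient of the free monoid \<open>lists X\<close> by the congruence generated by \<open>R\<close>.\<close>

definition presented_monoid :: "'a set \<Rightarrow> ('a list \<times> 'a list) set \<Rightarrow> 'a list set monoid" where
  "presented_monoid X R =
    \<lparr> carrier = lists X // word_cong X R,
      monoid.mult = (\<lambda>A B. \<Union>u\<in>A. \<Union>v\<in>B. word_class X R (u @ v)),
      one = word_class X R [] \<rparr>"

text \<open>The monoid \<open>M\<close> has the presentation with generators \<open>X\<close> and relations \<open>R\<close>, where the letter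
  \<open>x\<close> stands for the element \<open>\<iota> x\<close> of \<open>M\<close>. An element of \<open>iso\<close> is a multiplicative
  bijection, so it automatically preserves the unit.\<close>

definition has_presentation ::
  "('m, 'b) monoid_scheme \<Rightarrow> ('a \<Rightarrow> 'm) \<Rightarrow> 'a set \<Rightarrow> ('a list \<times> 'a list) set \<Rightarrow> bool" where
  "has_presentation M \<iota> X R \<longleftrightarrow>
    monoid M \<and> R \<subseteq> lists X \<times> lists X \<and>
    (\<exists>h \<in> iso (presented_monoid X R) M. \<forall>x\<in>X. h (word_class X R [x]) = \<iota> x)"

lemma word_cong_subset:
  assumes "R \<subseteq> lists X \<times> lists X"
  shows "word_cong X R \<subseteq> lists X \<times> lists X"
proof
  fix p
  assume "p \<in> word_cong X R"
  then show "p \<in> lists X \<times> lists X"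
    by induction (use assms in auto)
qed

lemma equiv_word_cong:
  assumes "R \<subseteq> lists X \<times> lists X"
  shows "equiv (lists X) (word_cong X R)"
proof (rule equivI)
  show "word_cong X R \<subseteq> lists X \<times> lists X"
    by (rule word_cong_subset[OF assms])
  show "refl_on (lists X) (word_cong X R)"
    by (rule refl_onI) (rule word_cong.refl)
  show "sym (word_cong X R)"
    by (rule symI) (rule word_cong.sym)
  show "trans (word_cong X R)"
    by (rule transI) (rule word_cong.trans)
qed

lemma word_class_mult:
  assumes R: "R \<subseteq> lists X \<times> lists X" and "u \<in> lists X" "v \<in> lists X"
  shows "word_class X R u \<otimes>\<^bsub>presented_monoid X R\<^esub> word_class X R v = word_class X R (u @ v)"
proof -
  have 1: "word_class X R (u' @ v') = word_class X R (u @ v)"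
    if "u' \<in> word_class X R u" "v' \<in> word_class X R v" for u' v'
    using that equiv_class_eq[OF equiv_word_cong[OF R] word_cong.append, of u u' v v']
    by (simp add: word_class_def)
  have 2: "u \<in> word_class X R u" "v \<in> word_class X R v"
    using assms by (auto simp: word_class_def intro: word_cong.refl)
  have "(\<Union>u'\<in>word_class X R u. \<Union>v'\<in>word_class X R v. word_class X R (u' @ v'))
      = word_class X R (u @ v)"
    using 1 2 by blast
  then show ?thesis
    by (simp add: presented_monoid_def)
qed

lemma monoid_presented_monoid:
  assumes R: "R \<subseteq> lists X \<times> lists X"
  shows "monoid (presented_monoid X R)"
proof -
  have car: "x \<in> carrier (presented_monoid X R) \<longleftrightarrow> (\<exists>u\<in>lists X. x = word_class X R u)" for x
    by (auto simp: presented_monoid_def quotient_def word_class_def)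
  have one: "\<one>\<^bsub>presented_monoid X R\<^esub> = word_class X R []"
    by (simp add: presented_monoid_def)
  have app: "u @ v \<in> lists X" if "u \<in> lists X" "v \<in> lists X" for u v
    using that by simp
  note mult = word_class_mult[OF R]
  show ?thesis
  proof (rule monoidI, unfold car one)
    show "\<exists>u\<in>lists X. x \<otimes>\<^bsub>presented_monoid X R\<^esub> y = word_class X R u"
      if "\<exists>u\<in>lists X. x = word_class X R u" "\<exists>u\<in>lists X. y = word_class X R u" for x y
      using that mult app by metis
  qed (use mult app lists.Nil in \<open>(metis append.assoc append.left_neutral append.right_neutral)+\<close>)
qed


section \<open>The virtual singular twin monoid\<close>

datatype vstm_gen = S nat | \<tau> nat | \<nu> nat

definition vstm_gens :: "nat \<Rightarrow> vstm_gen set" where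
  "vstm_gens n = {g i | g i. g \<in> {S, \<tau>, \<nu>} \<and> i \<in> {1..<n}}"

text \<open>In both families of relations below, the final intersection discards the relations in which
  some letter is not a generator for the given \<open>n\<close>; all index ranges come from it.\<close>

definition vstm_rels :: "nat \<Rightarrow> (vstm_gen list \<times> vstm_gen list) set" where
  "vstm_rels n =
    ({([S i, S i], []) | i. True}
     \<union> {([\<nu> i, \<nu> i], []) | i. True}
     \<union> {([\<tau> i, S i], [S i, \<tau> i]) | i. True}
     \<union> {([S i, S j, \<tau> i], [\<tau> j, S i, S j]) | i j. \<bar>int i - int j\<bar> = 1}
     \<union> {([\<nu> i, \<nu> j, \<nu> i], [\<nu> j, \<nu> i, \<nu> j]) | i j. \<bar>int i - int j\<bar> = 1}
     \<union> {([\<nu> i, S j, \<nu> i], [\<nu> j, S i, \<nu> j]) | i j. \<bar>int i - int j\<bar> = 1}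
     \<union> {([\<nu> i, \<tau> j, \<nu> i], [\<nu> j, \<tau> i, \<nu> j]) | i j. \<bar>int i - int j\<bar> = 1}
     \<union> {([g i, h j], [h j, g i]) | g h i j.
          g \<in> {S, \<tau>, \<nu>} \<and> h \<in> {S, \<tau>, \<nu>} \<and> \<bar>int i - int j\<bar> \<ge> 2})
    \<inter> (lists (vstm_gens n) \<times> lists (vstm_gens n))"

definition VSTM :: "nat \<Rightarrow> vstm_gen list set monoid" where
  "VSTM n = presented_monoid (vstm_gens n) (vstm_rels n)"

definition vstm_elem :: "nat \<Rightarrow> vstm_gen list \<Rightarrow> vstm_gen list set" where
  "vstm_elem n w = word_class (vstm_gens n) (vstm_rels n) w"

definition reduced_gens :: "nat \<Rightarrow> vstm_gen set" where
  "reduced_gens n = ({S 1, \<tau> 1} \<union> range \<nu>) \<inter> vstm_gens n"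

definition reduced_rels :: "nat \<Rightarrow> (vstm_gen list \<times> vstm_gen list) set" where
  "reduced_rels n =
    ({([\<nu> i, \<nu> j, \<nu> i], [\<nu> j, \<nu> i, \<nu> j]) | i j. \<bar>int i - int j\<bar> = 1}
     \<union> {([\<nu> i, \<nu> j], [\<nu> j, \<nu> i]) | i j. \<bar>int i - int j\<bar> \<ge> 2}
     \<union> {([\<nu> i, \<nu> i], []) | i. True}
     \<union> {([S 1, S 1], [])}
     \<union> {([S 1, \<tau> 1], [\<tau> 1, S 1])}
     \<union> {([\<tau> 1, \<nu> i], [\<nu> i, \<tau> 1]) | i. i \<ge> 3}
     \<union> {([S 1, \<nu> i], [\<nu> i, S 1]) | i. i \<ge> 3}
     \<union> {([\<tau> 1] @ [\<nu> 1, \<nu> 2, S 1, \<nu> 2, \<nu> 1] @ [S 1],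
         [\<nu> 1, \<nu> 2, S 1, \<nu> 2, \<nu> 1] @ [S 1] @ [\<nu> 1, \<nu> 2, \<tau> 1, \<nu> 2, \<nu> 1])}
     \<union> {([S 1] @ [\<nu> 2, \<nu> 3, \<nu> 1, \<nu> 2, S 1, \<nu> 2, \<nu> 1, \<nu> 3, \<nu> 2],
         [\<nu> 2, \<nu> 3, \<nu> 1, \<nu> 2, S 1, \<nu> 2, \<nu> 1, \<nu> 3, \<nu> 2] @ [S 1])}
     \<union> {([\<tau> 1] @ [\<nu> 2, \<nu> 3, \<nu> 1, \<nu> 2, S 1, \<nu> 2, \<nu> 1, \<nu> 3, \<nu> 2],
         [\<nu> 2, \<nu> 3, \<nu> 1, \<nu> 2, S 1, \<nu> 2, \<nu> 1, \<nu> 3, \<nu> 2] @ [\<tau> 1])}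
     \<union> {([\<tau> 1] @ [\<nu> 2, \<nu> 3, \<nu> 1, \<nu> 2, \<tau> 1, \<nu> 2, \<nu> 1, \<nu> 3, \<nu> 2],
         [\<nu> 2, \<nu> 3, \<nu> 1, \<nu> 2, \<tau> 1, \<nu> 2, \<nu> 1, \<nu> 3, \<nu> 2] @ [\<tau> 1])})
    \<inter> (lists (reduced_gens n) \<times> lists (reduced_gens n))"

text \<open>\<open>\<nu>_up a b\<close> is the word \<open>\<nu> a, \<nu> (a+1), \<dots>, \<nu> b\<close> and \<open>\<nu>_down b a\<close> is its reversal.\<close>

definition \<nu>_up :: "nat \<Rightarrow> nat \<Rightarrow> vstm_gen list" where
  "\<nu>_up a b = map \<nu> [a..<Suc b]"

definition \<nu>_down :: "nat \<Rightarrow> nat \<Rightarrow> vstm_gen list" where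
  "\<nu>_down b a = rev (\<nu>_up a b)"

end

theory Submission
  imports Defs
begin

text \<open>
  The involutions \<open>\<nu> i\<close> satisfy the Coxeter relations of the symmetric group, and the relation
  \<open>\<nu> i \<cdot> S (i + 1) \<cdot> \<nu> i = \<nu> (i + 1) \<cdot> S i \<cdot> \<nu> (i + 1)\<close> says that \<open>S (i + 1)\<close> is the conjugate of
  \<open>S i\<close> by \<open>\<nu> i \<cdot> \<nu> (i + 1)\<close>; the same holds for \<open>\<tau>\<close>. Hence every \<open>S i\<close> and \<open>\<tau> i\<close> is a conjugate of
  \<open>S 1\<close> or \<open>\<tau> 1\<close> by a word in the \<open>\<nu>\<close>'s and can be eliminated by a Tietze transformation. What has to
  be shown is that each defining relation, after this substitution, follows from the reduced ones.

  The symmetric group acts on the conjugates of \<open>S 1\<close> as on ordered pairs of distinct points: \<open>S 1\<close>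
  is attached to the pair \<open>(1, 2)\<close> and its stabiliser, generated by the \<open>\<nu> k\<close> with \<open>k \<ge> 3\<close>, commutes
  with it. Since permutations move two pairs to any other two with the same coincidences among their
  points, a relation between conjugates has to be known in one position only, and conjugation carries
  it to all similar ones: the relations with one index start
  at index 1, the exchange relations at the indices \<open>(1, 2)\<close>, and the commutations at distance at
  least 2 at the indices \<open>(1, 3)\<close>. The reduced relations provide all these starting cases but two.
  The exchange relation with the roles of 1 and 2 interchanged follows by cancelling the involutions \<open>S i\<close>
  (\<open>transported_exchange\<close>), and the missing commutation of \<open>S 1\<close> with \<open>\<tau> 3\<close> is the image of that of
  \<open>\<tau> 1\<close> with \<open>S 3\<close> under the permutation that interchanges the pairs \<open>(1, 2)\<close> and \<open>(3, 4)\<close>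
  (\<open>transported_commute_swap\<close>).

  The computations are done in arbitrary actions of the generators by self-maps of a type, where
  composition is associative by nature and a word identity is an equation between iterated function
  applications. Nothing is lost, since a presented monoid acts faithfully on itself by left
  multiplication (\<open>word_cong_if_actions_agree\<close>).
\<close>

section \<open>Presentations and actions\<close>

text \<open>
  The Tietze transformation that removes the generators outside \<open>Y\<close>. Substituting \<open>\<phi>\<close> sends the
  congruence of \<open>R\<close> into that of \<open>R'\<close> and fixes the words over \<open>Y\<close>, so the inclusion of the words
  over \<open>Y\<close> is injective on classes; it is surjective because each letter equals its substitute.
\<close>

lemma tietze_elimination:
  assumes R: "R \<subseteq> lists X \<times> lists X" and R': "R' \<subseteq> lists Y \<times> lists Y"
    and sub: "Y \<subseteq> X" and sound: "R' \<subseteq> word_cong X R"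
    and \<phi>_in: "\<And>x. x \<in> X \<Longrightarrow> \<phi> x \<in> lists Y"
    and \<phi>_id: "\<And>y. y \<in> Y \<Longrightarrow> \<phi> y = [y]"
    and \<phi>_eq: "\<And>x. x \<in> X \<Longrightarrow> ([x], \<phi> x) \<in> word_cong X R"
    and \<phi>_rel: "\<And>u v. (u, v) \<in> R \<Longrightarrow> (concat (map \<phi> u), concat (map \<phi> v)) \<in> word_cong Y R'"
  shows "has_presentation (presented_monoid X R) (\<lambda>x. word_class X R [x]) Y R'"
proof -
  have up: "(u, v) \<in> word_cong X R" if "(u, v) \<in> word_cong Y R'" for u v
    using that
  proof (induction "(u, v)" arbitrary: u v)
    case base
    then show ?case using sound by blast
  next
    case refl
    then show ?case using sub by (auto intro: word_cong.refl)
  next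
    case sym
    then show ?case by (blast intro: word_cong.sym)
  next
    case trans
    then show ?case by (blast intro: word_cong.trans)
  next
    case append
    then show ?case by (blast intro: word_cong.append)
  qed
  have \<phi>_words: "concat (map \<phi> w) \<in> lists Y" if "w \<in> lists X" for w
    using that \<phi>_in by (induction w) auto
  have down: "(concat (map \<phi> u), concat (map \<phi> v)) \<in> word_cong Y R'"
    if "(u, v) \<in> word_cong X R" for u v
    using that
  proof (induction "(u, v)" arbitrary: u v)
    case base
    then show ?case using \<phi>_rel by blast
  next
    case refl
    then show ?case by (intro word_cong.refl \<phi>_words)
  next
    case sym
    then show ?case by (blast intro: word_cong.sym)
  next
    case trans
    then show ?case by (blast intro: word_cong.trans)
  next
    case append
    then show ?case by (simp add: word_cong.append)
  qed
  have retract: "concat (map \<phi> w) = w" if "w \<in> lists Y" for w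
    using that \<phi>_id by (induction w) auto
  have expand: "(w, concat (map \<phi> w)) \<in> word_cong X R" if "w \<in> lists X" for w
    using that
  proof (induction w)
    case Nil
    then show ?case by (simp add: word_cong.refl)
  next
    case (Cons x w)
    then have "([x] @ w, \<phi> x @ concat (map \<phi> w)) \<in> word_cong X R"
      by (intro word_cong.append \<phi>_eq) auto
    then show ?case by simp
  qed
  have class_eq: "word_class X R u = word_class X R v \<longleftrightarrow> (u, v) \<in> word_cong X R"
    if "u \<in> lists X" "v \<in> lists X" for u v
    using eq_equiv_class_iff[OF equiv_word_cong[OF R] that] by (simp add: word_class_def)
  have class_eq': "word_class Y R' u = word_class Y R' v \<longleftrightarrow> (u, v) \<in> word_cong Y R'"
    if "u \<in> lists Y" "v \<in> lists Y" for u v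
    using eq_equiv_class_iff[OF equiv_word_cong[OF R'] that] by (simp add: word_class_def)
  have car: "carrier (presented_monoid X R) = word_class X R ` lists X"
    by (auto simp: presented_monoid_def quotient_def word_class_def)
  have car': "carrier (presented_monoid Y R') = word_class Y R' ` lists Y"
    by (auto simp: presented_monoid_def quotient_def word_class_def)
  have lists_sub: "w \<in> lists X" if "w \<in> lists Y" for w
    using that sub by auto
  \<comment> \<open>The map induced by the inclusion: congruent words over \<open>Y\<close> have the same class over \<open>X\<close>, so the
    union below is over copies of a single class.\<close>
  define h where "h A = (\<Union>w\<in>A. word_class X R w)" for A
  have h: "h (word_class Y R' w) = word_class X R w" if w: "w \<in> lists Y" for w
  proof -
    have "word_class X R w' = word_class X R w" if "(w, w') \<in> word_cong Y R'" for w'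
      using up[OF that] word_cong_subset[OF R] class_eq by blast
    moreover have "(w, w) \<in> word_cong Y R'"
      using w by (rule word_cong.refl)
    ultimately show ?thesis
      unfolding h_def word_class_def[of Y] by blast
  qed
  have "h \<in> hom (presented_monoid Y R') (presented_monoid X R)"
  proof (rule homI, unfold car car')
    show "h A \<in> word_class X R ` lists X" if "A \<in> word_class Y R' ` lists Y" for A
      using that h lists_sub by force
    show "h (A \<otimes>\<^bsub>presented_monoid Y R'\<^esub> B) = h A \<otimes>\<^bsub>presented_monoid X R\<^esub> h B"
      if A: "A \<in> word_class Y R' ` lists Y" and B: "B \<in> word_class Y R' ` lists Y" for A B
    proof -
      from A B obtain a b where ab: "a \<in> lists Y" "b \<in> lists Y"
        and AB: "A = word_class Y R' a" "B = word_class Y R' b" by blast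
      then have "a @ b \<in> lists Y" by simp
      with ab show ?thesis
        unfolding AB by (simp only: h lists_sub word_class_mult[OF R] word_class_mult[OF R'])
    qed
  qed
  moreover have "inj_on h (carrier (presented_monoid Y R'))"
  proof (rule inj_onI, unfold car')
    fix A B
    assume "A \<in> word_class Y R' ` lists Y" "B \<in> word_class Y R' ` lists Y" and eq: "h A = h B"
    then obtain u v where u: "u \<in> lists Y" "A = word_class Y R' u"
      and v: "v \<in> lists Y" "B = word_class Y R' v"
      by blast
    then have "(u, v) \<in> word_cong X R"
      using eq h class_eq lists_sub by metis
    from down[OF this] show "A = B"
      using u v retract class_eq' by simp
  qed
  moreover have "h ` carrier (presented_monoid Y R') = carrier (presented_monoid X R)"
  proof -
    have "word_class X R ` lists X \<subseteq> word_class X R ` lists Y"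
    proof (rule image_subsetI)
      fix w
      assume w: "w \<in> lists X"
      then have "word_class X R w = word_class X R (concat (map \<phi> w))"
        using class_eq[OF w lists_sub[OF \<phi>_words[OF w]]] expand by simp
      with \<phi>_words[OF w] show "word_class X R w \<in> word_class X R ` lists Y" by (rule image_eqI[rotated])
    qed
    moreover have "word_class X R ` lists Y \<subseteq> word_class X R ` lists X"
      using lists_sub by (intro image_mono subsetI)
    moreover have "h ` word_class Y R' ` lists Y = word_class X R ` lists Y"
      unfolding image_image using h by (rule image_cong[OF HOL.refl])
    ultimately show ?thesis
      unfolding car car' by simp
  qed
  ultimately have "h \<in> iso (presented_monoid Y R') (presented_monoid X R)"
    by (simp add: iso_def bij_betw_def)
  moreover have "h (word_class Y R' [x]) = word_class X R [x]" if "x \<in> Y" for x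
    using that by (simp add: h)
  ultimately show ?thesis
    unfolding has_presentation_def using monoid_presented_monoid[OF R] R' by blast
qed

definition satisfies :: "('a \<Rightarrow> 'b \<Rightarrow> 'b) \<Rightarrow> ('a list \<times> 'a list) set \<Rightarrow> bool" where
  "satisfies f R \<longleftrightarrow> (\<forall>(u, v) \<in> R. \<forall>x. foldr f u x = foldr f v x)"

lemma satisfiesD: "satisfies f R \<Longrightarrow> (u, v) \<in> R \<Longrightarrow> foldr f u x = foldr f v x"
  unfolding satisfies_def by blast

text \<open>
  Cayley's theorem for presented monoids: the monoid acts on itself by left multiplication, and the
  class of a word is recovered as the image of the unit.
\<close>

lemma word_cong_if_actions_agree:
  fixes R :: "('a list \<times> 'a list) set"
  assumes R: "R \<subseteq> lists X \<times> lists X" and u: "u \<in> lists X" and v: "v \<in> lists X"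
    and agree: "\<And>(f :: 'a \<Rightarrow> 'a list set \<Rightarrow> 'a list set) c. satisfies f R \<Longrightarrow> foldr f u c = foldr f v c"
  shows "(u, v) \<in> word_cong X R"
proof -
  let ?M = "presented_monoid X R"
  \<comment> \<open>Sets of words that are no class are fixed, so that the relations hold on the whole type.\<close>
  define f where "f x c = (if c \<in> carrier ?M then word_class X R [x] \<otimes>\<^bsub>?M\<^esub> c else c)" for x c
  have car: "carrier ?M = word_class X R ` lists X"
    by (auto simp: presented_monoid_def quotient_def word_class_def)
  have class_eq: "word_class X R a = word_class X R b \<longleftrightarrow> (a, b) \<in> word_cong X R"
    if "a \<in> lists X" "b \<in> lists X" for a b
    using eq_equiv_class_iff[OF equiv_word_cong[OF R] that] by (simp add: word_class_def)
  have on_class: "foldr f a (word_class X R w) = word_class X R (a @ w)"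
    if "a \<in> lists X" "w \<in> lists X" for a w
    using that by (induction a) (auto simp: f_def car word_class_mult[OF R])
  have off_class: "foldr f a c = c" if "c \<notin> carrier ?M" for a c
    using that by (induction a) (auto simp: f_def)
  have "satisfies f R"
    unfolding satisfies_def
  proof clarify
    fix a b c
    assume ab: "(a, b) \<in> R"
    then have ab_in: "a \<in> lists X" "b \<in> lists X" using R by auto
    show "foldr f a c = foldr f b c"
    proof (cases "c \<in> carrier ?M")
      case True
      then obtain w where w: "w \<in> lists X" "c = word_class X R w"
        using car by blast
      have "(a @ w, b @ w) \<in> word_cong X R"
        using ab w by (intro word_cong.append word_cong.base word_cong.refl)
      then have "word_class X R (a @ w) = word_class X R (b @ w)"
        using class_eq ab_in w by simp
      then show ?thesis using on_class ab_in w by simp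
    qed (simp add: off_class)
  qed
  from agree[OF this, of "word_class X R []"] show ?thesis
    using on_class u v class_eq by simp
qed

section \<open>Families transported by adjacent transpositions\<close>

locale transposition_action =
  fixes n :: nat and v :: "nat \<Rightarrow> 'b \<Rightarrow> 'b"
  assumes inv: "0 < i \<Longrightarrow> i < n \<Longrightarrow> v i (v i x) = x"
    and braid: "0 < i \<Longrightarrow> Suc i < n \<Longrightarrow> v i (v (Suc i) (v i x)) = v (Suc i) (v i (v (Suc i) x))"
    and far: "0 < i \<Longrightarrow> 0 < j \<Longrightarrow> i < n \<Longrightarrow> j < n \<Longrightarrow> i + 2 \<le> j \<or> j + 2 \<le> i \<Longrightarrow> v i (v j x) = v j (v i x)"
begin

text \<open>
  Here \<open>g i\<close> plays the role of the conjugate of \<open>g 1\<close> that is attached to the pair \<open>(i, i + 1)\<close>. The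
  first condition makes \<open>g 1\<close> invariant under the stabiliser of \<open>(1, 2)\<close>, and \<open>v i \<circ> v (i + 1)\<close> moves
  the pair \<open>(i, i + 1)\<close> to \<open>(i + 1, i + 2)\<close>.
\<close>

definition transported :: "(nat \<Rightarrow> 'b \<Rightarrow> 'b) \<Rightarrow> bool" where
  "transported g \<longleftrightarrow>
    (\<forall>k x. 3 \<le> k \<longrightarrow> k < n \<longrightarrow> v k (g 1 x) = g 1 (v k x)) \<and>
    (\<forall>i x. 0 < i \<longrightarrow> Suc i < n \<longrightarrow> g (Suc i) x = v i (v (Suc i) (g i (v (Suc i) (v i x)))))"

lemma transported_Suc:
  "transported g \<Longrightarrow> 0 < i \<Longrightarrow> Suc i < n \<Longrightarrow> g (Suc i) x = v i (v (Suc i) (g i (v (Suc i) (v i x))))"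
  unfolding transported_def by blast

text \<open>
  The transposition \<open>v k\<close> fixes both points of the pair \<open>(i, i + 1)\<close>. If \<open>k\<close> is also at distance at
  least 2 from \<open>i - 1\<close>, it commutes with every factor of the recursive formula for \<open>g i\<close>. The case
  \<open>k = i - 2\<close> is the only one with content: moving \<open>v k\<close> through the conjugator
  \<open>v (k + 1) \<circ> v (k + 2) \<circ> v k \<circ> v (k + 1)\<close> by two braid moves turns it into \<open>v (k + 2)\<close>, which
  commutes with \<open>g k\<close>.
\<close>

lemma transported_far:
  assumes g: "transported g" and "0 < i" "i < n" "0 < k" "k < n" "i + 2 \<le> k \<or> k + 2 \<le> i"
  shows "v k (g i x) = g i (v k x)"
  using assms(2-)
proof (induction i arbitrary: k x rule: less_induct)
  case (less j)
  show ?case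
  proof (cases "j = 1")
    case True
    with less.prems g show ?thesis unfolding transported_def by auto
  next
    case False
    with less.prems obtain i where i: "j = Suc i" "0 < i"
      by (cases j) auto
    have rec: "g j y = v i (v (Suc i) (g i (v (Suc i) (v i y))))" for y
      using transported_Suc[OF g] i less.prems by simp
    show ?thesis
    proof (cases "Suc k = i")
      case False
      then have "v k (v i y) = v i (v k y)" "v k (v (Suc i) y) = v (Suc i) (v k y)"
        "v k (g i y) = g i (v k y)" for y
        using less.prems i by (auto intro: far less.IH)
      then show ?thesis by (simp add: rec)
    next
      case True
      let ?a = "v k" and ?b = "v (Suc k)" and ?c = "v (Suc (Suc k))"
      have rec': "g (Suc k) y = ?a (?b (g k (?b (?a y))))" for y
        using i less.prems True by (intro transported_Suc[OF g]) auto
      have ac: "?a (?c y) = ?c (?a y)" and cg: "?c (g k y) = g k (?c y)" for y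
        using less.prems i True by (auto intro: far less.IH)
      have ab: "?a (?b (?a y)) = ?b (?a (?b y))" and bc: "?b (?c (?b y)) = ?c (?b (?c y))" for y
        using less.prems i True by (auto intro: braid)
      have rec2: "g j y = ?b (?c (?a (?b (g k (?b (?a (?c (?b y))))))))" for y
        using rec True rec' by simp
      have "?a (g j x) = ?a (?b (?a (?c (?b (g k (?b (?a (?c (?b x)))))))))"
        by (simp only: rec2 ac)
      also have "\<dots> = ?b (?a (?c (?b (?c (g k (?b (?a (?c (?b x)))))))))"
        by (simp only: ab bc)
      also have "\<dots> = ?b (?a (?c (?b (g k (?c (?b (?c (?a (?b x)))))))))"
        by (simp only: cg ac)
      also have "\<dots> = ?b (?a (?c (?b (g k (?b (?c (?a (?b (?a x)))))))))"
        by (simp only: ab bc[symmetric])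
      also have "\<dots> = g j (?a x)"
        by (simp only: rec2 ac)
      finally show ?thesis .
    qed
  qed
qed

lemma braid_adjacent:
  assumes "0 < i" "i < n" "0 < j" "j < n" "\<bar>int i - int j\<bar> = 1"
  shows "v i (v j (v i x)) = v j (v i (v j x))"
proof -
  have "j = Suc i \<or> i = Suc j" using assms(5) by auto
  then show ?thesis using assms braid by auto
qed

lemma transported_adjacent:
  assumes g: "transported g" and "0 < i" "i < n" "0 < j" "j < n" "\<bar>int i - int j\<bar> = 1"
  shows "v i (g j (v i x)) = v j (g i (v j x))"
proof -
  have "j = Suc i \<or> i = Suc j" using assms(6) by auto
  then show ?thesis using assms by (auto simp: transported_Suc[OF g] inv)
qed

text \<open>
  A single conjugator that shifts both \<open>g i\<close> and \<open>g (i + 1)\<close> by one: the cycle \<open>c\<close> sends each of the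
  points \<open>i\<close>, \<open>i + 1\<close>, \<open>i + 2\<close> to its successor. It is used to shift relations that involve two
  neighbouring indices.
\<close>

lemma transported_rotate:
  assumes g: "transported g" and i: "0 < i" "Suc (Suc i) < n"
  defines "c \<equiv> \<lambda>x. v i (v (Suc i) (v (Suc (Suc i)) x))"
  shows "g (Suc i) (c x) = c (g i x)" "g (Suc (Suc i)) (c x) = c (g (Suc i) x)"
proof -
  have "v (Suc (Suc i)) (g i x) = g i (v (Suc (Suc i)) x)" "v i (g (Suc (Suc i)) y) = g (Suc (Suc i)) (v i y)" for x y
    using i by (auto intro: transported_far[OF g])
  note far' = this
  have inv': "v i (v i y) = y" "v (Suc i) (v (Suc i) y) = y" "v (Suc (Suc i)) (v (Suc (Suc i)) y) = y" for y
    using i by (auto intro: inv)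
  have rec: "g (Suc i) y = v i (v (Suc i) (g i (v (Suc i) (v i y))))"
    "g (Suc (Suc i)) y = v (Suc i) (v (Suc (Suc i)) (g (Suc i) (v (Suc (Suc i)) (v (Suc i) y))))" for y
    using i by (auto intro: transported_Suc[OF g])
  show "g (Suc i) (c x) = c (g i x)"
    by (simp only: c_def rec(1) inv' far'(1))
  show "g (Suc (Suc i)) (c x) = c (g (Suc i) x)"
    by (simp only: c_def far'(2)[symmetric]) (simp only: rec(2) inv')
qed

lemma transported_involution:
  assumes g: "transported g" and g1: "\<And>x. g 1 (g 1 x) = x" and "0 < i" "i < n"
  shows "g i (g i x) = x"
  using assms(3-)
proof (induction i arbitrary: x rule: nat_induct_non_zero)
  case 1
  show ?case by (rule g1)
next
  case (Suc i)
  have "v i (v i y) = y" "v (Suc i) (v (Suc i) y) = y" for y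
    using Suc.hyps Suc.prems by (auto intro: inv)
  moreover have "g i (g i y) = y" for y
    using Suc.prems by (intro Suc.IH) auto
  moreover have "g (Suc i) y = v i (v (Suc i) (g i (v (Suc i) (v i y))))" for y
    using Suc.hyps Suc.prems by (intro transported_Suc[OF g]) auto
  ultimately show ?case by (simp only:)
qed

lemma transported_commute_same:
  assumes g: "transported g" and h: "transported h" and gh1: "\<And>x. g 1 (h 1 x) = h 1 (g 1 x)"
    and "0 < i" "i < n"
  shows "g i (h i x) = h i (g i x)"
  using assms(4-)
proof (induction i arbitrary: x rule: nat_induct_non_zero)
  case 1
  show ?case by (rule gh1)
next
  case (Suc i)
  have "v i (v i y) = y" "v (Suc i) (v (Suc i) y) = y" for y
    using Suc.hyps Suc.prems by (auto intro: inv)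
  moreover have "g i (h i y) = h i (g i y)" for y
    using Suc.prems by (intro Suc.IH) auto
  moreover have "g (Suc i) y = v i (v (Suc i) (g i (v (Suc i) (v i y))))"
    "h (Suc i) y = v i (v (Suc i) (h i (v (Suc i) (v i y))))" for y
    using Suc.hyps Suc.prems by (auto intro!: transported_Suc[OF g] transported_Suc[OF h])
  ultimately show ?case by (simp only:)
qed

text \<open>
  The involution \<open>w\<close> below interchanges the pairs \<open>(1, 2)\<close> and \<open>(3, 4)\<close>, hence \<open>g 1\<close> with \<open>g 3\<close> and
  \<open>h 1\<close> with \<open>h 3\<close>.
\<close>

lemma transported_commute_swap:
  assumes g: "transported g" and h: "transported h" and n: "3 < n"
    and gh: "\<And>x. g 1 (h 3 x) = h 3 (g 1 x)"
  shows "h 1 (g 3 x) = g 3 (h 1 x)"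
proof -
  let ?w = "\<lambda>x. v 2 (v 3 (v 1 (v 2 x)))"
  have v13: "v 3 (v 1 y) = v 1 (v 3 y)" for y
    using n by (intro far) auto
  have ww: "?w (?w y) = y" for y
  proof -
    have "v 1 (v 1 z) = z" "v 2 (v 2 z) = z" "v 3 (v 3 z) = z" for z
      using n by (auto intro!: inv)
    then show ?thesis by (simp only: v13)
  qed
  have three: "k 3 y = ?w (k 1 (?w y))" if "transported k" for k y
  proof -
    have "k 2 z = v 1 (v 2 (k 1 (v 2 (v 1 z))))" "k 3 z = v 2 (v 3 (k 2 (v 3 (v 2 z))))" for z
      using transported_Suc[OF that, of 1 z] transported_Suc[OF that, of 2 z] n
      by (simp_all add: numeral_3_eq_3 numeral_2_eq_2)
    then show ?thesis by (simp only: v13)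
  qed
  have "h 1 (g 3 x) = ?w (h 3 (g 1 (?w x)))"
    by (simp only: three[OF g] three[OF h] ww)
  also have "\<dots> = ?w (g 1 (h 3 (?w x)))"
    by (simp only: gh)
  also have "\<dots> = g 3 (h 1 x)"
    by (simp only: three[OF g] three[OF h] ww)
  finally show ?thesis .
qed

text \<open>
  Starting from the indices \<open>(1, 3)\<close>, the second index is raised up to \<open>j\<close>, conjugating by elements
  that commute with \<open>g 1\<close>; then the first one is raised up to \<open>i\<close>, conjugating by elements that
  commute with \<open>h j\<close>. In this order every conjugator stays away from the index that is kept.
\<close>

lemma transported_commute_far:
  assumes g: "transported g" and h: "transported h"
    and gh: "\<And>x. 3 < n \<Longrightarrow> g 1 (h 3 x) = h 3 (g 1 x)"
    and "0 < i" "i + 2 \<le> j" "j < n"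
  shows "g i (h j x) = h j (g i x)"
proof -
  have first: "g 1 (h j x) = h j (g 1 x)" if "3 \<le> j" "j < n" for j x
    using that
  proof (induction j arbitrary: x rule: dec_induct)
    case base
    then show ?case by (rule gh)
  next
    case (step j)
    have "g 1 (v j y) = v j (g 1 y)" "g 1 (v (Suc j) y) = v (Suc j) (g 1 y)" for y
      using step by (auto intro!: transported_far[OF g, symmetric])
    moreover have "g 1 (h j y) = h j (g 1 y)" for y
      using step by simp
    moreover have "h (Suc j) y = v j (v (Suc j) (h j (v (Suc j) (v j y))))" for y
      using step by (intro transported_Suc[OF h]) auto
    ultimately show ?case
      by (simp only:)
  qed
  show ?thesis
    using assms(4-)
  proof (induction i arbitrary: x rule: nat_induct_non_zero)
    case 1
    then show ?case using first by simp
  next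
    case (Suc i)
    have "v i (h j y) = h j (v i y)" "v (Suc i) (h j y) = h j (v (Suc i) y)" for y
      using Suc by (auto intro!: transported_far[OF h])
    then show ?case
      using Suc by (simp add: transported_Suc[OF g])
  qed
qed

text \<open>
  The first equation is shifted from the indices \<open>(1, 2)\<close> by \<open>transported_rotate\<close>. The second one is
  the first one multiplied by \<open>s i \<circ> s (i + 1)\<close> on both sides, where the involutions cancel.
\<close>

lemma transported_exchange:
  assumes s: "transported s" and t: "transported t"
    and s1: "\<And>x. s 1 (s 1 x) = x"
    and st: "\<And>x. 2 < n \<Longrightarrow> t 1 (s 2 (s 1 x)) = s 2 (s 1 (t 2 x))"
    and i: "0 < i" "Suc i < n"
  shows "t i (s (Suc i) (s i x)) = s (Suc i) (s i (t (Suc i) x))"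
    and "t (Suc i) (s i (s (Suc i) x)) = s i (s (Suc i) (t i x))"
proof -
  have *: "t i (s (Suc i) (s i x)) = s (Suc i) (s i (t (Suc i) x))" for x
    using i
  proof (induction i arbitrary: x rule: nat_induct_non_zero)
    case 1
    then show ?case using st by (simp add: numeral_2_eq_2)
  next
    case (Suc i)
    let ?c = "\<lambda>x. v i (v (Suc i) (v (Suc (Suc i)) x))"
    note rot = transported_rotate[OF s Suc(1) Suc.prems] transported_rotate[OF t Suc(1) Suc.prems]
    have "t (Suc i) (s (Suc (Suc i)) (s (Suc i) (?c y))) = ?c (t i (s (Suc i) (s i y)))" for y
      by (simp only: rot)
    also have "?c (t i (s (Suc i) (s i y))) = ?c (s (Suc i) (s i (t (Suc i) y)))" for y
      using Suc.IH Suc.prems by simp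
    also have "?c (s (Suc i) (s i (t (Suc i) y))) = s (Suc (Suc i)) (s (Suc i) (t (Suc (Suc i)) (?c y)))" for y
      by (simp only: rot)
    finally have "t (Suc i) (s (Suc (Suc i)) (s (Suc i) (?c y)))
      = s (Suc (Suc i)) (s (Suc i) (t (Suc (Suc i)) (?c y)))" for y .
    \<comment> \<open>The cycle is surjective: \<open>x\<close> is the image of the point inserted here.\<close>
    from this[of "v (Suc (Suc i)) (v (Suc i) (v i x))"] show ?case
      using Suc(1) Suc.prems by (simp add: inv)
  qed
  show "t i (s (Suc i) (s i x)) = s (Suc i) (s i (t (Suc i) x))" by (rule *)
  have ss: "s i (s i y) = y" "s (Suc i) (s (Suc i) y) = y" for y
    using i by (auto intro!: transported_involution[OF s s1])
  have "t (Suc i) (s i (s (Suc i) x)) = s i (s (Suc i) (s (Suc i) (s i (t (Suc i) (s i (s (Suc i) x))))))"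
    by (simp only: ss)
  also have "\<dots> = s i (s (Suc i) (t i x))"
    by (simp only: *[symmetric] ss)
  finally show "t (Suc i) (s i (s (Suc i) x)) = s i (s (Suc i) (t i x))" .
qed

end

section \<open>The two presentations of the virtual singular twin monoid\<close>

text \<open>
  The word for the generator with index \<open>i + 1\<close>; for \<open>i = 0\<close> both conjugators are empty, so the
  formula also covers the generators that are kept.
\<close>

definition conjugate_word :: "vstm_gen \<Rightarrow> nat \<Rightarrow> vstm_gen list" where
  "conjugate_word x i = \<nu>_down i 1 @ \<nu>_down (i + 1) 2 @ [x] @ \<nu>_up 2 (i + 1) @ \<nu>_up 1 i"

fun reduce :: "vstm_gen \<Rightarrow> vstm_gen list" where
  "reduce (S i) = conjugate_word (S 1) (i - 1)"
| "reduce (\<tau> i) = conjugate_word (\<tau> 1) (i - 1)"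
| "reduce (\<nu> i) = [\<nu> i]"

lemma gens_iff [simp]:
  "S i \<in> vstm_gens n \<longleftrightarrow> 0 < i \<and> i < n" "\<tau> i \<in> vstm_gens n \<longleftrightarrow> 0 < i \<and> i < n"
  "\<nu> i \<in> vstm_gens n \<longleftrightarrow> 0 < i \<and> i < n"
  unfolding vstm_gens_def by force+

lemma reduced_gens_iff [simp]:
  "S i \<in> reduced_gens n \<longleftrightarrow> i = 1 \<and> 1 < n" "\<tau> i \<in> reduced_gens n \<longleftrightarrow> i = 1 \<and> 1 < n"
  "\<nu> i \<in> reduced_gens n \<longleftrightarrow> 0 < i \<and> i < n"
  by (auto simp: reduced_gens_def)

lemma conjugate_word_0 [simp]: "conjugate_word x 0 = [x]"
  by (simp add: conjugate_word_def \<nu>_up_def \<nu>_down_def)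

lemma \<nu>_up_Suc: "a \<le> Suc b \<Longrightarrow> \<nu>_up a (Suc b) = \<nu>_up a b @ [\<nu> (Suc b)]"
  by (simp add: \<nu>_up_def)

lemma \<nu>_down_Suc: "a \<le> Suc b \<Longrightarrow> \<nu>_down (Suc b) a = \<nu> (Suc b) # \<nu>_down b a"
  by (simp add: \<nu>_down_def \<nu>_up_Suc)

lemma foldr_\<nu>_commute:
  assumes "\<And>i y. i \<in> I \<Longrightarrow> g (f (\<nu> i) y) = f (\<nu> i) (g y)" and "w \<in> lists (\<nu> ` I)"
  shows "g (foldr f w y) = foldr f w (g y)"
  using assms(2) by (induction w) (auto simp: assms(1))

text \<open>
  The explicit conjugators satisfy the recursion of a transported family, because \<open>\<nu> (i + 2)\<close> commutes
  with the letters \<open>\<nu> 1, \<dots>, \<nu> i\<close> that separate it from \<open>\<nu> (i + 1)\<close>.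
\<close>

lemma conjugate_word_Suc:
  assumes "transposition_action n (\<lambda>i. f (\<nu> i))" and i: "Suc (Suc i) < n"
  shows "foldr f (conjugate_word x (Suc i)) y =
    f (\<nu> (Suc i)) (f (\<nu> (Suc (Suc i))) (foldr f (conjugate_word x i) (f (\<nu> (Suc (Suc i))) (f (\<nu> (Suc i)) y))))"
proof -
  interpret transposition_action n "\<lambda>i. f (\<nu> i)" by fact
  have in_lists: "\<nu>_down i 1 \<in> lists (\<nu> ` {1..i})" "\<nu>_up 1 i \<in> lists (\<nu> ` {1..i})"
    by (auto simp: \<nu>_down_def \<nu>_up_def)
  have comm: "f (\<nu> (Suc (Suc i))) (f (\<nu> j) z) = f (\<nu> j) (f (\<nu> (Suc (Suc i))) z)" if "j \<in> {1..i}" for j z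
    using that i by (intro far) auto
  note comm' = foldr_\<nu>_commute[where f = f and g = "f (\<nu> (Suc (Suc i)))" and I = "{1..i}", OF comm in_lists(1), simplified]
    foldr_\<nu>_commute[where f = f and g = "f (\<nu> (Suc (Suc i)))" and I = "{1..i}", OF comm in_lists(2), simplified]
  show ?thesis
    by (simp add: conjugate_word_def \<nu>_up_Suc \<nu>_down_Suc comm')
qed

lemma vstm_rels_words: "vstm_rels n \<subseteq> lists (vstm_gens n) \<times> lists (vstm_gens n)"
  unfolding vstm_rels_def by blast

lemma reduced_rels_words: "reduced_rels n \<subseteq> lists (reduced_gens n) \<times> lists (reduced_gens n)"
  unfolding reduced_rels_def by blast


lemma foldr_concat_map: "foldr f (concat (map \<phi> w)) x = foldr (\<lambda>y. foldr f (\<phi> y)) w x"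
  by (induction w) auto

lemma transposition_action_reduced:
  assumes f: "satisfies f (reduced_rels n)"
  shows "transposition_action n (\<lambda>i. f (\<nu> i))"
proof
  show "f (\<nu> i) (f (\<nu> i) x) = x" if "0 < i" "i < n" for i x
    using satisfiesD[OF f, of "[\<nu> i, \<nu> i]" "[]" x] that by (simp add: reduced_rels_def)
  show "f (\<nu> i) (f (\<nu> (Suc i)) (f (\<nu> i) x)) = f (\<nu> (Suc i)) (f (\<nu> i) (f (\<nu> (Suc i)) x))"
    if "0 < i" "Suc i < n" for i x
    using satisfiesD[OF f, of "[\<nu> i, \<nu> (Suc i), \<nu> i]" "[\<nu> (Suc i), \<nu> i, \<nu> (Suc i)]" x] that
    by (simp add: reduced_rels_def)
  show "f (\<nu> i) (f (\<nu> j) x) = f (\<nu> j) (f (\<nu> i) x)"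
    if "0 < i" "0 < j" "i < n" "j < n" "i + 2 \<le> j \<or> j + 2 \<le> i" for i j x
  proof -
    have "\<bar>int i - int j\<bar> \<ge> 2" using that by auto
    then show ?thesis
      using satisfiesD[OF f, of "[\<nu> i, \<nu> j]" "[\<nu> j, \<nu> i]" x] that by (simp add: reduced_rels_def)
  qed
qed

lemma transposition_action_vstm:
  assumes f: "satisfies f (vstm_rels n)"
  shows "transposition_action n (\<lambda>i. f (\<nu> i))"
proof
  show "f (\<nu> i) (f (\<nu> i) x) = x" if "0 < i" "i < n" for i x
    using satisfiesD[OF f, of "[\<nu> i, \<nu> i]" "[]" x] that by (simp add: vstm_rels_def)
  show "f (\<nu> i) (f (\<nu> (Suc i)) (f (\<nu> i) x)) = f (\<nu> (Suc i)) (f (\<nu> i) (f (\<nu> (Suc i)) x))"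
    if "0 < i" "Suc i < n" for i x
    using satisfiesD[OF f, of "[\<nu> i, \<nu> (Suc i), \<nu> i]" "[\<nu> (Suc i), \<nu> i, \<nu> (Suc i)]" x] that
    by (simp add: vstm_rels_def)
  show "f (\<nu> i) (f (\<nu> j) x) = f (\<nu> j) (f (\<nu> i) x)"
    if "0 < i" "0 < j" "i < n" "j < n" "i + 2 \<le> j \<or> j + 2 \<le> i" for i j x
  proof -
    have "\<bar>int i - int j\<bar> \<ge> 2" using that by auto
    then have "([\<nu> i, \<nu> j], [\<nu> j, \<nu> i]) \<in> vstm_rels n"
      using that unfolding vstm_rels_def by fastforce
    from satisfiesD[OF f this] show ?thesis by simp
  qed
qed

lemma vstm_far:
  assumes f: "satisfies f (vstm_rels n)" and "g \<in> {S, \<tau>, \<nu>}" "h \<in> {S, \<tau>, \<nu>}"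
    and "0 < i" "0 < j" "i < n" "j < n" "i + 2 \<le> j \<or> j + 2 \<le> i"
  shows "f (g i) (f (h j) x) = f (h j) (f (g i) x)"
proof -
  have "\<bar>int i - int j\<bar> \<ge> 2" using assms by auto
  then have "([g i, h j], [h j, g i]) \<in> vstm_rels n"
    using assms(2-) unfolding vstm_rels_def by fastforce
  from satisfiesD[OF f this] show ?thesis by simp
qed

lemma transported_vstm:
  assumes f: "satisfies f (vstm_rels n)" and g: "g \<in> {S, \<tau>}"
  shows "transposition_action.transported n (\<lambda>i. f (\<nu> i)) (\<lambda>i. f (g i))"
proof -
  interpret transposition_action n "\<lambda>i. f (\<nu> i)"
    by (rule transposition_action_vstm[OF f])
  have "f (g (Suc i)) x = f (\<nu> i) (f (\<nu> (Suc i)) (f (g i) (f (\<nu> (Suc i)) (f (\<nu> i) x))))"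
    if i: "0 < i" "Suc i < n" for i x
  proof -
    have "([\<nu> i, g (Suc i), \<nu> i], [\<nu> (Suc i), g i, \<nu> (Suc i)]) \<in> vstm_rels n"
      using i g by (auto simp: vstm_rels_def)
    from satisfiesD[OF f this]
    have "f (\<nu> i) (f (g (Suc i)) (f (\<nu> i) y)) = f (\<nu> (Suc i)) (f (g i) (f (\<nu> (Suc i)) y))" for y
      by simp
    from arg_cong[OF this, of "f (\<nu> i)" "f (\<nu> i) x"] show ?thesis
      using i by (simp add: inv)
  qed
  moreover have "f (\<nu> k) (f (g 1) x) = f (g 1) (f (\<nu> k) x)" if "3 \<le> k" "k < n" for k x
    using vstm_far[OF f, of \<nu> g k 1] g that by auto
  ultimately show ?thesis
    unfolding transported_def by blast
qed

text \<open>
  Generators and substitutes satisfy the same recursion and agree at index 1.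
\<close>

lemma reduce_gen_sound:
  assumes f: "satisfies f (vstm_rels n)" and "x \<in> vstm_gens n"
  shows "foldr f (reduce x) y = f x y"
proof -
  interpret transposition_action n "\<lambda>i. f (\<nu> i)"
    by (rule transposition_action_vstm[OF f])
  have *: "foldr f (conjugate_word (g 1) i) y = f (g (Suc i)) y"
    if "g \<in> {S, \<tau>}" "Suc i < n" for g i y
    using that(2)
  proof (induction i arbitrary: y)
    case (Suc i)
    then show ?case
      using conjugate_word_Suc[OF transposition_action_axioms, of i]
        transported_Suc[OF transported_vstm[OF f that(1)], of "Suc i"] by simp
  qed simp
  show ?thesis
    using assms(2) *[of S] *[of \<tau>] by (cases x) auto
qed

text \<open>
  The long relations are the exchange relation at \<open>(1, 2)\<close> and the commutations at \<open>(1, 3)\<close>, with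
  \<open>S 2\<close>, \<open>\<tau> 2\<close>, \<open>S 3\<close> and \<open>\<tau> 3\<close> written as conjugates of \<open>S 1\<close> and \<open>\<tau> 1\<close>.
\<close>

lemma reduced_rels_sound:
  assumes f: "satisfies f (vstm_rels n)"
  shows "satisfies f (reduced_rels n)"
proof -
  interpret transposition_action n "\<lambda>i. f (\<nu> i)"
    by (rule transposition_action_vstm[OF f])
  have two: "f (g 2) x = f (\<nu> 1) (f (\<nu> 2) (f (g 1) (f (\<nu> 2) (f (\<nu> 1) x))))"
    if "g \<in> {S, \<tau>}" "2 < n" for g x
    using transported_Suc[OF transported_vstm[OF f that(1)], of 1] that(2) by (simp add: numeral_2_eq_2)
  have three: "f (g 3) x = f (\<nu> 2) (f (\<nu> 3) (f (g 2) (f (\<nu> 3) (f (\<nu> 2) x))))"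
    if "g \<in> {S, \<tau>}" "3 < n" for g x
    using transported_Suc[OF transported_vstm[OF f that(1)], of 2] that(2) by (simp add: numeral_3_eq_3)
  have S_inv: "f (S 1) (f (S 1) x) = x" if "1 < n" for x
    using satisfiesD[OF f, of "[S 1, S 1]" "[]" x] that by (simp add: vstm_rels_def)
  have comm_1: "f (\<tau> 1) (f (S 1) x) = f (S 1) (f (\<tau> 1) x)" if "1 < n" for x
    using satisfiesD[OF f, of "[\<tau> 1, S 1]" "[S 1, \<tau> 1]" x] that by (simp add: vstm_rels_def)
  have exchange: "f (\<tau> 1) (f (S 2) (f (S 1) x)) = f (S 2) (f (S 1) (f (\<tau> 2) x))" if "2 < n" for x
    using satisfiesD[OF f, of "[S 2, S 1, \<tau> 2]" "[\<tau> 1, S 2, S 1]" x] that by (simp add: vstm_rels_def)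
  have far_1: "f (g 1) (f (h k) x) = f (h k) (f (g 1) x)"
    if "g \<in> {S, \<tau>, \<nu>}" "h \<in> {S, \<tau>, \<nu>}" "3 \<le> k" "k < n" for g h k x
    using that by (intro vstm_far[OF f]) auto
  show ?thesis
    unfolding satisfies_def
  proof clarify
    fix u w x
    assume "(u, w) \<in> reduced_rels n"
    then show "foldr f u x = foldr f w x"
      unfolding reduced_rels_def
    proof (elim IntE UnE, goal_cases)
      case 1
      then show ?case using braid_adjacent by auto
    next
      case 2
      then show ?case by (auto intro!: far)
    next
      case 3
      then show ?case using inv by auto
    next
      case 4
      then show ?case using S_inv by auto
    next
      case 5
      then show ?case using comm_1 by auto
    next
      case 6
      then show ?case using far_1[of \<tau> \<nu>] by auto
    next
      case 7
      then show ?case using far_1[of S \<nu>] by auto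
    next
      case 8
      then show ?case using exchange[of x] two by auto
    next
      case 9
      then show ?case using far_1[of S S 3 x] two three by auto
    next
      case 10
      then show ?case using far_1[of \<tau> S 3 x] two three by auto
    next
      case 11
      then show ?case using far_1[of \<tau> \<tau> 3 x] two three by auto
    qed
  qed
qed

text \<open>
  The heart of the theorem: the substitutes \<open>F (S i)\<close> and \<open>F (\<tau> i)\<close> form transported families, and the
  reduced relations are the starting cases from which the relations between them propagate.
\<close>

lemma vstm_rels_reduce:
  assumes f: "satisfies f (reduced_rels n)"
  shows "satisfies (\<lambda>x. foldr f (reduce x)) (vstm_rels n)"
proof -
  interpret transposition_action n "\<lambda>i. f (\<nu> i)"
    by (rule transposition_action_reduced[OF f])
  define F where "F x = foldr f (reduce x)" for x
  have F_\<nu>: "F (\<nu> i) = f (\<nu> i)" for i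
    by (simp add: F_def)
  have F_1: "F (S 1) = f (S 1)" "F (\<tau> 1) = f (\<tau> 1)"
    by (auto simp: F_def)
  have F_Suc: "F (g (Suc i)) x = f (\<nu> i) (f (\<nu> (Suc i)) (F (g i) (f (\<nu> (Suc i)) (f (\<nu> i) x))))"
    if "g \<in> {S, \<tau>}" "0 < i" "Suc i < n" for g i x
    using conjugate_word_Suc[OF transposition_action_axioms, of "i - 1"] that by (auto simp: F_def)
  have "f (\<nu> k) (f (S 1) x) = f (S 1) (f (\<nu> k) x)" "f (\<nu> k) (f (\<tau> 1) x) = f (\<tau> 1) (f (\<nu> k) x)"
    if "3 \<le> k" "k < n" for k x
    using satisfiesD[OF f, of "[S 1, \<nu> k]" "[\<nu> k, S 1]" x] satisfiesD[OF f, of "[\<tau> 1, \<nu> k]" "[\<nu> k, \<tau> 1]" x] that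
    by (simp_all add: reduced_rels_def)
  then have tr: "transported (\<lambda>i. F (g i))" if "g \<in> {S, \<tau>}" for g
    unfolding transported_def using F_Suc[OF that] F_1 that by auto
  have two: "F (g 2) x = f (\<nu> 1) (f (\<nu> 2) (f (g 1) (f (\<nu> 2) (f (\<nu> 1) x))))"
    if "g \<in> {S, \<tau>}" "2 < n" for g x
    using F_Suc[OF that(1), of 1] that F_1 by (auto simp: numeral_2_eq_2)
  have three: "F (g 3) x = f (\<nu> 2) (f (\<nu> 3) (f (\<nu> 1) (f (\<nu> 2) (f (g 1) (f (\<nu> 2) (f (\<nu> 1) (f (\<nu> 3) (f (\<nu> 2) x))))))))"
    if "g \<in> {S, \<tau>}" "3 < n" for g x
    using F_Suc[OF that(1), of 2] that two by (simp add: numeral_3_eq_3)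
  note trS = tr[of S, simplified] and tr\<tau> = tr[of \<tau>, simplified]
  have S_inv: "F (S 1) (F (S 1) x) = x" if "1 < n" for x
    using satisfiesD[OF f, of "[S 1, S 1]" "[]" x] that F_1 by (simp add: reduced_rels_def)
  have comm_1: "F (\<tau> 1) (F (S 1) x) = F (S 1) (F (\<tau> 1) x)" if "1 < n" for x
    using satisfiesD[OF f, of "[S 1, \<tau> 1]" "[\<tau> 1, S 1]" x] that F_1 by (simp add: reduced_rels_def)
  have exchange: "F (\<tau> 1) (F (S 2) (F (S 1) x)) = F (S 2) (F (S 1) (F (\<tau> 2) x))" if "2 < n" for x
    using satisfiesD[OF f, of "[\<tau> 1] @ [\<nu> 1, \<nu> 2, S 1, \<nu> 2, \<nu> 1] @ [S 1]"
        "[\<nu> 1, \<nu> 2, S 1, \<nu> 2, \<nu> 1] @ [S 1] @ [\<nu> 1, \<nu> 2, \<tau> 1, \<nu> 2, \<nu> 1]" x] that F_1 two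
    by (simp add: reduced_rels_def)
  have SS: "F (S 1) (F (S 3) x) = F (S 3) (F (S 1) x)" if "3 < n" for x
    using satisfiesD[OF f, of "[S 1] @ [\<nu> 2, \<nu> 3, \<nu> 1, \<nu> 2, S 1, \<nu> 2, \<nu> 1, \<nu> 3, \<nu> 2]"
        "[\<nu> 2, \<nu> 3, \<nu> 1, \<nu> 2, S 1, \<nu> 2, \<nu> 1, \<nu> 3, \<nu> 2] @ [S 1]" x] that F_1 three
    by (simp add: reduced_rels_def)
  have \<tau>S: "F (\<tau> 1) (F (S 3) x) = F (S 3) (F (\<tau> 1) x)" if "3 < n" for x
    using satisfiesD[OF f, of "[\<tau> 1] @ [\<nu> 2, \<nu> 3, \<nu> 1, \<nu> 2, S 1, \<nu> 2, \<nu> 1, \<nu> 3, \<nu> 2]"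
        "[\<nu> 2, \<nu> 3, \<nu> 1, \<nu> 2, S 1, \<nu> 2, \<nu> 1, \<nu> 3, \<nu> 2] @ [\<tau> 1]" x] that F_1 three
    by (simp add: reduced_rels_def)
  have \<tau>\<tau>: "F (\<tau> 1) (F (\<tau> 3) x) = F (\<tau> 3) (F (\<tau> 1) x)" if "3 < n" for x
    using satisfiesD[OF f, of "[\<tau> 1] @ [\<nu> 2, \<nu> 3, \<nu> 1, \<nu> 2, \<tau> 1, \<nu> 2, \<nu> 1, \<nu> 3, \<nu> 2]"
        "[\<nu> 2, \<nu> 3, \<nu> 1, \<nu> 2, \<tau> 1, \<nu> 2, \<nu> 1, \<nu> 3, \<nu> 2] @ [\<tau> 1]" x] that F_1 three
    by (simp add: reduced_rels_def)
  have S\<tau>: "F (S 1) (F (\<tau> 3) x) = F (\<tau> 3) (F (S 1) x)" if "3 < n" for x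
    by (rule transported_commute_swap[where g = "\<lambda>i. F (\<tau> i)" and h = "\<lambda>i. F (S i)",
          OF tr\<tau> trS that \<tau>S[OF that]])
  have non_\<nu>_far: "F (g i) (F (h j) x) = F (h j) (F (g i) x)"
    if "g \<in> {S, \<tau>}" "h \<in> {S, \<tau>}" "0 < i" "i + 2 \<le> j" "j < n" for g h i j x
  proof -
    have start: "F (g 1) (F (h 3) y) = F (h 3) (F (g 1) y)" if "3 < n" for y
      using \<open>g \<in> {S, \<tau>}\<close> \<open>h \<in> {S, \<tau>}\<close> SS[OF that] \<tau>S[OF that] S\<tau>[OF that] \<tau>\<tau>[OF that]
      by blast
    show ?thesis
      using transported_commute_far[where g = "\<lambda>i. F (g i)" and h = "\<lambda>i. F (h i)",
          OF tr[OF that(1)] tr[OF that(2)] start that(3-5)] .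
  qed
  have all_far: "F (g i) (F (h j) x) = F (h j) (F (g i) x)"
    if gh: "g \<in> {S, \<tau>, \<nu>}" "h \<in> {S, \<tau>, \<nu>}" and ij: "0 < i" "i < n" "0 < j" "j < n"
      and dist: "i + 2 \<le> j \<or> j + 2 \<le> i" for g h i j x
  proof (cases "g = \<nu>")
    case g: True
    show ?thesis
    proof (cases "h = \<nu>")
      case True
      show ?thesis unfolding g True F_\<nu> by (rule far[OF ij(1,3,2,4) dist])
    next
      case False
      then have "transported (\<lambda>i. F (h i))" using gh tr by auto
      from transported_far[OF this, of j i x] show ?thesis using g ij dist by (auto simp: F_\<nu>)
    qed
  next
    case False
    then have g: "g \<in> {S, \<tau>}" using gh by auto
    show ?thesis
    proof (cases "h = \<nu>")
      case True
      from transported_far[OF tr[OF g], of i j x] True show ?thesis using ij dist by (auto simp: F_\<nu>)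
    next
      case False
      then have "h \<in> {S, \<tau>}" using gh by auto
      then show ?thesis
        using dist non_\<nu>_far[OF g, of h i j x] non_\<nu>_far[OF _ g, of h j i x] ij by auto
    qed
  qed
  have exchange_adjacent: "F (S i) (F (S j) (F (\<tau> i) x)) = F (\<tau> j) (F (S i) (F (S j) x))"
    if ij: "0 < i" "i < n" "0 < j" "j < n" and adj: "\<bar>int i - int j\<bar> = 1" for i j x
  proof -
    have "1 < n" using that by linarith
    note ex = transported_exchange[where s = "\<lambda>i. F (S i)" and t = "\<lambda>i. F (\<tau> i)",
        OF trS tr\<tau> S_inv[OF this] exchange]
    have "j = Suc i \<or> i = Suc j" using adj by auto
    then show ?thesis using ij ex by auto
  qed
  have "foldr F u x = foldr F w x" if "(u, w) \<in> vstm_rels n" for u w x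
    using that unfolding vstm_rels_def
  proof (elim IntE UnE, goal_cases)
    case 1
    then show ?case using transported_involution[where g = "\<lambda>i. F (S i)", OF trS S_inv] by auto
  next
    case 2
    then show ?case using inv by (auto simp: F_\<nu>)
  next
    case 3
    then show ?case using transported_commute_same[where g = "\<lambda>i. F (\<tau> i)" and h = "\<lambda>i. F (S i)",
          OF tr\<tau> trS comm_1] by auto
  next
    case 4
    then show ?case using exchange_adjacent by auto
  next
    case 5
    then show ?case using braid_adjacent by (auto simp: F_\<nu>)
  next
    case 6
    then show ?case using transported_adjacent[where g = "\<lambda>i. F (S i)", OF trS] by (auto simp: F_\<nu>)
  next
    case 7
    then show ?case using transported_adjacent[where g = "\<lambda>i. F (\<tau> i)", OF tr\<tau>] by (auto simp: F_\<nu>)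
  next
    case 8
    then obtain g h i j where uw: "u = [g i, h j]" "w = [h j, g i]"
      and gh: "g \<in> {S, \<tau>, \<nu>}" "h \<in> {S, \<tau>, \<nu>}" and dist: "\<bar>int i - int j\<bar> \<ge> 2"
      by blast
    have "0 < i" "i < n" "0 < j" "j < n"
      using 8(1) gh by (auto simp: uw)
    moreover have "i + 2 \<le> j \<or> j + 2 \<le> i"
      using dist by auto
    ultimately show ?case using all_far[OF gh] by (simp add: uw)
  qed
  then show ?thesis
    unfolding satisfies_def F_def by blast
qed

theorem theorem23:
  fixes n :: nat
  shows "has_presentation (VSTM n) (\<lambda>g. vstm_elem n [g]) (reduced_gens n) (reduced_rels n) \<and>
    (\<forall>i. 1 \<le> i \<and> i + 2 \<le> n \<longrightarrow>
      vstm_elem n [S (i + 1)] =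
        vstm_elem n (\<nu>_down i 1 @ \<nu>_down (i + 1) 2 @ [S 1] @ \<nu>_up 2 (i + 1) @ \<nu>_up 1 i) \<and>
      vstm_elem n [\<tau> (i + 1)] =
        vstm_elem n (\<nu>_down i 1 @ \<nu>_down (i + 1) 2 @ [\<tau> 1] @ \<nu>_up 2 (i + 1) @ \<nu>_up 1 i))"
proof -
  have sub: "reduced_gens n \<subseteq> vstm_gens n"
    by (simp add: reduced_gens_def)
  have conj_words: "conjugate_word x i \<in> lists (reduced_gens n)"
    if "x \<in> reduced_gens n" "Suc i < n" for x i
    using that by (auto simp: conjugate_word_def \<nu>_up_def \<nu>_down_def)
  have reduce_words: "reduce x \<in> lists (reduced_gens n)" if "x \<in> vstm_gens n" for x
    using that conj_words[of "S 1"] conj_words[of "\<tau> 1"]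
    by (cases x) simp_all
  have gen_eq: "([x], reduce x) \<in> word_cong (vstm_gens n) (vstm_rels n)" if "x \<in> vstm_gens n" for x
    using that sub reduce_words[OF that]
    by (intro word_cong_if_actions_agree[OF vstm_rels_words]) (auto simp: reduce_gen_sound)
  have "has_presentation (presented_monoid (vstm_gens n) (vstm_rels n))
    (\<lambda>g. word_class (vstm_gens n) (vstm_rels n) [g]) (reduced_gens n) (reduced_rels n)"
  proof (rule tietze_elimination[where \<phi> = reduce])
    show "reduced_rels n \<subseteq> word_cong (vstm_gens n) (vstm_rels n)"
    proof clarify
      fix u w
      assume uw: "(u, w) \<in> reduced_rels n"
      then have "u \<in> lists (vstm_gens n)" "w \<in> lists (vstm_gens n)"
        using reduced_rels_words lists_mono[OF sub] by blast+
      then show "(u, w) \<in> word_cong (vstm_gens n) (vstm_rels n)"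
        by (rule word_cong_if_actions_agree[OF vstm_rels_words])
          (rule satisfiesD[OF reduced_rels_sound uw])
    qed
    show "(concat (map reduce u), concat (map reduce w)) \<in> word_cong (reduced_gens n) (reduced_rels n)"
      if uw: "(u, w) \<in> vstm_rels n" for u w
    proof (rule word_cong_if_actions_agree[OF reduced_rels_words])
      have "u \<in> lists (vstm_gens n)" "w \<in> lists (vstm_gens n)"
        using uw vstm_rels_words by blast+
      then show "concat (map reduce u) \<in> lists (reduced_gens n)"
        "concat (map reduce w) \<in> lists (reduced_gens n)"
        using reduce_words by fastforce+
      show "foldr f (concat (map reduce u)) c = foldr f (concat (map reduce w)) c"
        if "satisfies f (reduced_rels n)" for f :: "vstm_gen \<Rightarrow> vstm_gen list set \<Rightarrow> vstm_gen list set" and c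
        unfolding foldr_concat_map by (rule satisfiesD[OF vstm_rels_reduce[OF that] uw])
    qed
    show "reduce y = [y]" if "y \<in> reduced_gens n" for y
      using that by (cases y) auto
  qed (use vstm_rels_words reduced_rels_words sub reduce_words gen_eq in auto)
  moreover have "vstm_elem n [x] = vstm_elem n (reduce x)" if "x \<in> vstm_gens n" for x
    unfolding vstm_elem_def word_class_def
    by (rule equiv_class_eq[OF equiv_word_cong[OF vstm_rels_words] gen_eq[OF that]])
  ultimately show ?thesis
    by (auto simp: VSTM_def vstm_elem_def conjugate_word_def)
qed

end
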